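(* Let $L<H$ be reals, $\Theta=\{L,H\}^n$, and let $\mathcal{A}\subseteq\{0,1\}^n$ be a set of feasible (binary) allocations. If an algorithm $A:\Theta\to\mathcal{A}$ minimizes the weighted social cost breaking ties consistently, then the $\left(\frac12\right)$-linear mechanism with algorithm $A$ is strongly bribeproof.
   Context: There is a set $N=\{1,\dots,n\}$ of $n\ge 2$ agents and a set $\mathcal{A}$ of feasible allocations; $a_i$ is the amount of work allocated to agent $i$, whose cost for $a\in\mathcal{A}$ is $a_i\theta_i$, where $\theta_i\in\Theta_i\subseteq\mathbb{R}$ is her private type. $\Theta=\Theta_1\times\cdots\times\Theta_n$. A mechanism is a pair $(A,p)$ with $A:\Theta\to\mathcal{A}$ (the algorithm) and $p:\Theta\to\mathbb{R}^n$ (payments made to the agents). $(A,p)$ is strongly bribeproof if for all $\theta\in\Theta$ and all $i\ne j$ in $N$, and all $\hat\theta\in\Theta$ obtained from $\theta$ by changing the $i$-th and/or $j$-th entries arbitrarily (within $\Theta_i$, $\Theta_j$), $$p_i(\theta)-A_i(\theta)\theta_i+p_j(\theta)-A_j(\theta)\theta_j\ge p_i(\hat\theta)-A_i(\hat\theta)\theta_i+p_j(\hat\theta)-A_j(\hat\theta)\theta_j,$$ and moreover it is strategyproof: $p_i(\theta)-A_i(\theta)\theta_i\ge p_i(\hat\theta)-A_i(\hat\theta)\theta_i$ for all $i$, $\theta$ and all $\hat\theta$ obtained from $\theta$ by changing only the $i$-th entry. The $\left(\frac12\right)$-linear mechanism with algorithm $A$ has $p_i(\theta)=A_i(\theta)\,\frac{L+H}{2}+f_i$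 for all $i,\theta$, with arbitrary real constants $f_i$. $A$ minimizes the weighted social cost if there are nonnegative constants $\{\alpha_i\}_{i\in N}$ and arbitrary real constants $\{\beta_a\}_{a\in\mathcal{A}}$ such that for all $\theta\in\Theta$, $A(\theta)\in\arg\min_{a\in\mathcal{A}}\operatorname{sum}(a,\theta)$, where $\operatorname{sum}(a,\theta):=\left(\sum_{i\in N}\alpha_i a_i\theta_i\right)+\beta_a$. It does so breaking ties consistently if there is a total order $\preceq$ on $\mathcal{A}$ such that for all $\theta\in\Theta$ and all $a'\in\mathcal{A}$: if $\operatorname{sum}(A(\theta),\theta)=\operatorname{sum}(a',\theta)$ then $A(\theta)\preceq a'$. *)

theory Defs
  imports "HOL-Analysis.Analysis"
begin

text \<open>
  Agents are the elements of the finite type \<open>'n\<close>. Allocations, type profiles and payments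
  are vectors in \<open>real ^ 'n\<close>. Algorithms and payment functions are total functions, but every
  definition below inspects their values only on the set \<open>\<Theta>\<close> of type profiles.
\<close>

definition vec_Pi :: "('n::finite \<Rightarrow> real set) \<Rightarrow> (real ^ 'n) set" where
  "vec_Pi S = {x. \<forall>i. x $ i \<in> S i}"

definition utility ::
  "(real ^ 'n \<Rightarrow> real ^ 'n) \<Rightarrow> (real ^ 'n \<Rightarrow> real ^ 'n) \<Rightarrow> 'n::finite \<Rightarrow> real ^ 'n \<Rightarrow> real ^ 'n \<Rightarrow> real"
where \<comment> \<open>agent \<open>i\<close>, true profile \<open>\<theta>\<close>, reported profile \<open>\<theta>'\<close>\<close>
  "utility A p i \<theta> \<theta>' = p \<theta>' $ i - A \<theta>' $ i * \<theta> $ i"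

definition strategyproof ::
  "(real ^ 'n::finite) set \<Rightarrow> (real ^ 'n \<Rightarrow> real ^ 'n) \<Rightarrow> (real ^ 'n \<Rightarrow> real ^ 'n) \<Rightarrow> bool" where
  "strategyproof \<Theta> A p \<longleftrightarrow>
    (\<forall>i. \<forall>\<theta>\<in>\<Theta>. \<forall>\<theta>'\<in>\<Theta>. (\<forall>k. k \<noteq> i \<longrightarrow> \<theta>' $ k = \<theta> $ k) \<longrightarrow>
      utility A p i \<theta> \<theta> \<ge> utility A p i \<theta> \<theta>')"

definition strongly_bribeproof ::
  "(real ^ 'n::finite) set \<Rightarrow> (real ^ 'n \<Rightarrow> real ^ 'n) \<Rightarrow> (real ^ 'n \<Rightarrow> real ^ 'n) \<Rightarrow> bool" where
  "strongly_bribeproof \<Theta> A p \<longleftrightarrow>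
    (\<forall>i j. i \<noteq> j \<longrightarrow> (\<forall>\<theta>\<in>\<Theta>. \<forall>\<theta>'\<in>\<Theta>. (\<forall>k. k \<noteq> i \<and> k \<noteq> j \<longrightarrow> \<theta>' $ k = \<theta> $ k) \<longrightarrow>
      utility A p i \<theta> \<theta> + utility A p j \<theta> \<theta> \<ge> utility A p i \<theta> \<theta>' + utility A p j \<theta> \<theta>')) \<and>
    strategyproof \<Theta> A p"

definition half_linear_mechanism ::
  "real \<Rightarrow> real \<Rightarrow> (real ^ 'n::finite) set \<Rightarrow> (real ^ 'n \<Rightarrow> real ^ 'n) \<Rightarrow> (real ^ 'n \<Rightarrow> real ^ 'n) \<Rightarrow> bool" where
  "half_linear_mechanism L H \<Theta> A p \<longleftrightarrow>
    (\<exists>f :: 'n \<Rightarrow> real. \<forall>\<theta>\<in>\<Theta>. \<forall>i. p \<theta> $ i = A \<theta> $ i * ((L + H) / 2) + f i)"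

definition weighted_sum ::
  "('n::finite \<Rightarrow> real) \<Rightarrow> (real ^ 'n \<Rightarrow> real) \<Rightarrow> real ^ 'n \<Rightarrow> real ^ 'n \<Rightarrow> real" where
  "weighted_sum \<alpha> \<beta> a \<theta> = (\<Sum>i\<in>UNIV. \<alpha> i * a $ i * \<theta> $ i) + \<beta> a"

definition minimizes_weighted_sum ::
  "('n::finite \<Rightarrow> real) \<Rightarrow> (real ^ 'n \<Rightarrow> real) \<Rightarrow> (real ^ 'n) set \<Rightarrow> (real ^ 'n) set \<Rightarrow>
    (real ^ 'n \<Rightarrow> real ^ 'n) \<Rightarrow> bool" where
  "minimizes_weighted_sum \<alpha> \<beta> \<Theta> \<A> A \<longleftrightarrow>
    (\<forall>\<theta>\<in>\<Theta>. is_arg_min (\<lambda>a. weighted_sum \<alpha> \<beta> a \<theta>) (\<lambda>a. a \<in> \<A>) (A \<theta>))"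

definition breaks_ties_consistently ::
  "('n::finite \<Rightarrow> real) \<Rightarrow> (real ^ 'n \<Rightarrow> real) \<Rightarrow> (real ^ 'n) set \<Rightarrow> (real ^ 'n) set \<Rightarrow>
    (real ^ 'n \<Rightarrow> real ^ 'n) \<Rightarrow> bool" where
  "breaks_ties_consistently \<alpha> \<beta> \<Theta> \<A> A \<longleftrightarrow>
    (\<exists>r. linear_order_on \<A> r \<and>
      (\<forall>\<theta>\<in>\<Theta>. \<forall>a'\<in>\<A>. weighted_sum \<alpha> \<beta> (A \<theta>) \<theta> = weighted_sum \<alpha> \<beta> a' \<theta> \<longrightarrow> (A \<theta>, a') \<in> r))"

text \<open>The same weights \<open>\<alpha>\<close>, \<open>\<beta>\<close> are used for the minimization and for the ties.\<close>

definition minimizes_weighted_social_cost_consistently ::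
  "(real ^ 'n::finite) set \<Rightarrow> (real ^ 'n) set \<Rightarrow> (real ^ 'n \<Rightarrow> real ^ 'n) \<Rightarrow> bool" where
  "minimizes_weighted_social_cost_consistently \<Theta> \<A> A \<longleftrightarrow>
    (\<exists>\<alpha> \<beta>. (\<forall>i. \<alpha> i \<ge> 0) \<and> minimizes_weighted_sum \<alpha> \<beta> \<Theta> \<A> A \<and>
      breaks_ties_consistently \<alpha> \<beta> \<Theta> \<A> A)"

end

(*
  If A chooses distinct allocations at two profiles, optimality of both choices together with
  consistent tie-breaking forces some agent k with differing types to get strictly more work at
  the profile where her type is lower. With two types placed symmetrically around the unit
  payment (L + H) / 2 and binary work, every agent's gain from truth-telling lies in
  {-(H - L) / 2, 0, (H - L) / 2}, and that agent k has the largest possible gain. Since k is one of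
  the two colluders, her gain compensates any loss of the other one.
*)
theory Submission imports Defs begin

text \<open>Adding the two optimality inequalities cancels \<open>\<beta>\<close> and bounds the
  \<open>\<alpha>\<close>-weighted sum of these products above by 0. If no product is negative, both
  inequalities must be ties; the tie-breaking order then puts each allocation before the other, and
  antisymmetry identifies them.\<close>

lemma eq_or_monotone_change:
  fixes A :: "real ^ 'n::finite \<Rightarrow> real ^ 'n"
  assumes "minimizes_weighted_social_cost_consistently \<Theta> \<A> A" "\<theta> \<in> \<Theta>" "\<theta>' \<in> \<Theta>"
  shows "A \<theta> = A \<theta>' \<or> (\<exists>k. (A \<theta> $ k - A \<theta>' $ k) * (\<theta> $ k - \<theta>' $ k) < 0)"
proof (rule disjCI)
  assume "\<nexists>k. (A \<theta> $ k - A \<theta>' $ k) * (\<theta> $ k - \<theta>' $ k) < 0"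
  then have nonneg: "(A \<theta> $ k - A \<theta>' $ k) * (\<theta> $ k - \<theta>' $ k) \<ge> 0" for k
    by (meson not_less)
  from assms(1) obtain \<alpha> \<beta> r where \<alpha>: "\<And>i. \<alpha> i \<ge> 0"
    and min: "minimizes_weighted_sum \<alpha> \<beta> \<Theta> \<A> A"
    and r: "linear_order_on \<A> r"
    and ties: "\<And>\<eta> a. \<lbrakk>\<eta> \<in> \<Theta>; a \<in> \<A>; weighted_sum \<alpha> \<beta> (A \<eta>) \<eta> = weighted_sum \<alpha> \<beta> a \<eta>\<rbrakk> \<Longrightarrow> (A \<eta>, a) \<in> r"
    unfolding minimizes_weighted_social_cost_consistently_def breaks_ties_consistently_def by metis
  let ?w = "weighted_sum \<alpha> \<beta>"
  have feasible: "A \<eta> \<in> \<A>" and le: "a \<in> \<A> \<Longrightarrow> ?w (A \<eta>) \<eta> \<le> ?w a \<eta>" if "\<eta> \<in> \<Theta>" for \<eta> a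
    using min that unfolding minimizes_weighted_sum_def is_arg_min_def by (auto simp: not_less)
  have "(?w (A \<theta>) \<theta> - ?w (A \<theta>') \<theta>) + (?w (A \<theta>') \<theta>' - ?w (A \<theta>) \<theta>')
      = (\<Sum>k\<in>UNIV. \<alpha> k * ((A \<theta> $ k - A \<theta>' $ k) * (\<theta> $ k - \<theta>' $ k)))"
    by (simp add: weighted_sum_def algebra_simps sum.distrib sum_subtractf)
  moreover have "\<dots> \<ge> 0"
    by (intro sum_nonneg mult_nonneg_nonneg[OF \<alpha> nonneg])
  moreover have "?w (A \<theta>) \<theta> \<le> ?w (A \<theta>') \<theta>" "?w (A \<theta>') \<theta>' \<le> ?w (A \<theta>) \<theta>'"
    using assms(2,3) feasible le by auto
  ultimately have "?w (A \<theta>) \<theta> = ?w (A \<theta>') \<theta>" "?w (A \<theta>') \<theta>' = ?w (A \<theta>) \<theta>'"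
    by linarith+
  then have "(A \<theta>, A \<theta>') \<in> r" "(A \<theta>', A \<theta>) \<in> r"
    using assms(2,3) feasible ties by auto
  then show "A \<theta> = A \<theta>'"
    using r by (auto simp: linear_order_on_def partial_order_on_def dest: antisymD)
qed

theorem theorem12:
  fixes L H :: real
    and \<Theta> \<A> :: "(real ^ 'n::finite) set"
    and A p :: "real ^ 'n \<Rightarrow> real ^ 'n"
  assumes "CARD('n) \<ge> 2"
    and "L < H"
    and "\<Theta> = vec_Pi (\<lambda>_. {L, H})"
    and "\<A> \<subseteq> vec_Pi (\<lambda>_. {0, 1})"
    and "A \<in> \<Theta> \<rightarrow> \<A>"
    and "minimizes_weighted_social_cost_consistently \<Theta> \<A> A"
    and "half_linear_mechanism L H \<Theta> A p"
  shows "strongly_bribeproof \<Theta> A p"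
proof -
  define gain where "gain k \<theta> \<theta>' = utility A p k \<theta> \<theta> - utility A p k \<theta> \<theta>'" for k \<theta> \<theta>'
  \<comment> \<open>The constants \<open>f k\<close> cancel, leaving the change in work times the
    margin of the unit payment over the true unit cost.\<close>
  have gain_eq: "gain k \<theta> \<theta>' = (A \<theta> $ k - A \<theta>' $ k) * ((L + H) / 2 - \<theta> $ k)"
    if "\<theta> \<in> \<Theta>" "\<theta>' \<in> \<Theta>" for k \<theta> \<theta>'
    using assms(7) that
    by (auto simp: half_linear_mechanism_def gain_def utility_def algebra_simps)
  have types: "\<theta> $ k = L \<or> \<theta> $ k = H" and work: "A \<theta> $ k = 0 \<or> A \<theta> $ k = 1"
    if "\<theta> \<in> \<Theta>" for k \<theta>
    using that assms(3,4,5) by (auto simp: vec_Pi_def Pi_def subset_iff)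
  \<comment> \<open>The work changes by at most 1, and the margin is \<open>(H - L) / 2\<close> for
    type \<open>L\<close> and \<open>-(H - L) / 2\<close> for type \<open>H\<close>.\<close>
  have gain_ge: "gain k \<theta> \<theta>' \<ge> - (H - L) / 2" if "\<theta> \<in> \<Theta>" "\<theta>' \<in> \<Theta>" for k \<theta> \<theta>'
    using types[OF that(1), of k] work[OF that(1), of k] work[OF that(2), of k] \<open>L < H\<close>
    by (auto simp: gain_eq[OF that] field_simps)
  have key: "(\<forall>k. gain k \<theta> \<theta>' = 0) \<or> (\<exists>k. \<theta>' $ k \<noteq> \<theta> $ k \<and> gain k \<theta> \<theta>' = (H - L) / 2)"
    if \<Theta>: "\<theta> \<in> \<Theta>" "\<theta>' \<in> \<Theta>" for \<theta> \<theta>'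
    using eq_or_monotone_change[OF assms(6) \<Theta>]
  proof (elim disjE exE)
    fix k
    assume "(A \<theta> $ k - A \<theta>' $ k) * (\<theta> $ k - \<theta>' $ k) < 0"
    \<comment> \<open>Truth-telling brings agent \<open>k\<close> one more unit of work if her true
      type is \<open>L\<close> and one less if it is \<open>H\<close>. In both cases work change and
      margin have the same sign.\<close>
    then have "\<theta>' $ k \<noteq> \<theta> $ k \<and> gain k \<theta> \<theta>' = (H - L) / 2"
      using types[OF \<Theta>(1), of k] types[OF \<Theta>(2), of k] work[OF \<Theta>(1), of k] work[OF \<Theta>(2), of k]
        \<open>L < H\<close>
      by (auto simp: gain_eq[OF \<Theta>] field_simps)
    then show ?thesis by blast
  qed (simp add: gain_eq[OF \<Theta>])
  have joint_gain: "gain i \<theta> \<theta>' + gain j \<theta> \<theta>' \<ge> 0"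
    if "\<theta> \<in> \<Theta>" "\<theta>' \<in> \<Theta>" "\<forall>k. k \<noteq> i \<and> k \<noteq> j \<longrightarrow> \<theta>' $ k = \<theta> $ k" for i j \<theta> \<theta>'
    using key[OF that(1,2)]
  proof (elim disjE exE)
    fix k
    assume k: "\<theta>' $ k \<noteq> \<theta> $ k \<and> gain k \<theta> \<theta>' = (H - L) / 2"
    then have "k = i \<or> k = j" using that(3) by blast
    then show ?thesis
      using k gain_ge[OF that(1,2), of i] gain_ge[OF that(1,2), of j] by auto
  qed simp
  \<comment> \<open>Strategyproofness is the degenerate coalition \<open>i = j\<close>, whose joint
    gain is twice the gain of \<open>i\<close>.\<close>
  have "gain i \<theta> \<theta>' \<ge> 0"
    if "\<theta> \<in> \<Theta>" "\<theta>' \<in> \<Theta>" "\<forall>k. k \<noteq> i \<longrightarrow> \<theta>' $ k = \<theta> $ k" for i \<theta> \<theta>'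
    using joint_gain[of \<theta> \<theta>' i i] that by simp
  with joint_gain show ?thesis
    unfolding strongly_bribeproof_def strategyproof_def gain_def
    by (smt (verit, best))
qed

end
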